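(* Let $p(\mathbf{y},\mathbf{z})$ be a model with observed data $\mathbf{y}$ (fixed) and latent vector $\mathbf{z}=(\mathbf{z}_1,\ldots,\mathbf{z}_K)$. Suppose that for each $i\in\{1,\ldots,K\}$ the conditional is conjugate to the exponential family $\{q_{\boldsymbol{\lambda}_i}\}$ with sufficient statistics $\mathbf{T}_i$, that is, there exists a function $\boldsymbol{\eta}_i$ such that $$\log p(\mathbf{z}_i\mid \mathbf{z}_{\backslash i},\mathbf{y}) = \langle \mathbf{T}_i(\mathbf{z}_i),\, \boldsymbol{\eta}_i(\mathbf{z}_{\backslash i},\mathbf{y})\rangle + \text{const.},$$ where the constant does not depend on $\mathbf{z}_i$. Let $q^*(\mathbf{z})=\prod_{i=1}^K q_i^*(\mathbf{z}_i)$, where each $q_i^*=q_{\boldsymbol{\lambda}_i^*}$ belongs to the $i$-th exponential family, with natural parameter $\boldsymbol{\lambda}_i^*$ and expectation parameter $\boldsymbol{\mu}_i^*=\mathbb{E}_{q_i^*}[\mathbf{T}_i(\mathbf{z}_i)]$. Then for each $i$ the following two conditions are equivalent: (1) $\log q_i^*(\mathbf{z}_i) = \mathbb{E}_{q^*_{\backslash i}}\left[\log p(\mathbf{y},\mathbf{z})\right] + \text{const.}$, as functions of $\mathbf{z}_i$, where the constant does not depend on $\mathbf{z}_i$; (2) $\boldsymbol{\lambda}_i^* = \nabla_{\boldsymbol{\mu}_i}\, \mathbb{E}_{q}\left[\log p(\mathbf{y},\mathbf{z})\right]\Big|_{\boldsymbol{\mu}_i=\boldsymbol{\mu}_i^*}$,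 where $q(\mathbf{z}) = q_{\boldsymbol{\lambda}_i}(\mathbf{z}_i)\, q^*_{\backslash i}(\mathbf{z}_{\backslash i})$ and the expectation is viewed as a function of the expectation parameter $\boldsymbol{\mu}_i$ of the $i$-th factor, the other factors being held fixed at $q_j^*$, $j\neq i$.
   Context: For each $i$, the exponential family has a constant base measure: $q_{\boldsymbol{\lambda}_i}(\mathbf{z}_i)\propto \exp(\langle \mathbf{T}_i(\mathbf{z}_i),\boldsymbol{\lambda}_i\rangle)$ (density with respect to a fixed reference measure), where $\boldsymbol{\lambda}_i$ is the natural parameter and $\mathbf{T}_i$ is the sufficient statistic, both taking values in a finite-dimensional real inner product space with inner product $\langle\cdot,\cdot\rangle$. The expectation parameter is $\boldsymbol{\mu}_i(\boldsymbol{\lambda}_i)=\mathbb{E}_{q_{\boldsymbol{\lambda}_i}}[\mathbf{T}_i(\mathbf{z}_i)]$. The natural and expectation parameters are in one-to-one correspondence: $\boldsymbol{\lambda}_i\mapsto\boldsymbol{\mu}_i(\boldsymbol{\lambda}_i)$ is a diffeomorphism from an open set of natural parameters onto an open set of expectation parameters, so that gradients with respect to $\boldsymbol{\mu}_i$ make sense. The notation $\mathbf{z}_{\backslash i}$ denotes all latent variables other than $\mathbf{z}_i$, and $q^*_{\backslash i}(\mathbf{z}_{\backslash i})=\prod_{j\ne i}q_j^*(\mathbf{z}_j)$. All expectations that appear are assumed to exist and be finite. *)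

theory Defs
  imports "HOL-Probability.Probability"
begin

section \<open>Calculus in a subspace\<close>

text \<open>
  The factors of the model may have parameter spaces of different dimensions. The parameter space
  of each factor is therefore a linear subspace \<open>V\<close>, with the induced inner product, of one
  Euclidean space \<open>'e\<close>; any finite family of finite-dimensional inner product spaces embeds in this
  way (in its orthogonal direct sum). Openness and derivatives are relative to \<open>V\<close>.
\<close>

definition C1_on :: "'e set \<Rightarrow> ('e::euclidean_space \<Rightarrow> 'e) \<Rightarrow> bool" where
  "C1_on S f \<longleftrightarrow>
     (\<exists>f' :: 'e \<Rightarrow> 'e \<Rightarrow>\<^sub>L 'e.
        (\<forall>x\<in>S. (f has_derivative blinfun_apply (f' x)) (at x within S)) \<and> continuous_on S f')"

definition C1_diffeomorphism :: "'e set \<Rightarrow> 'e set \<Rightarrow> ('e::euclidean_space \<Rightarrow> 'e) \<Rightarrow> bool" where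
  "C1_diffeomorphism S S' f \<longleftrightarrow> (\<exists>g. homeomorphism S S' f g \<and> C1_on S f \<and> C1_on S' g)"

text \<open>The requirement \<open>g \<in> V\<close> makes the gradient unique.\<close>

definition has_gradient_in :: "'e set \<Rightarrow> ('e::euclidean_space \<Rightarrow> real) \<Rightarrow> 'e \<Rightarrow> 'e \<Rightarrow> bool" where
  "has_gradient_in V f g x \<longleftrightarrow> g \<in> V \<and> (f has_derivative (\<lambda>h. h \<bullet> g)) (at x within V)"


section \<open>Exponential families with constant base measure\<close>

definition expfam_density ::
  "'z measure \<Rightarrow> ('z \<Rightarrow> 'e::euclidean_space) \<Rightarrow> 'e \<Rightarrow> 'z \<Rightarrow> real" where
  "expfam_density M T l x = exp (T x \<bullet> l) / (\<integral>x'. exp (T x' \<bullet> l) \<partial>M)"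

definition expfam :: "'z measure \<Rightarrow> ('z \<Rightarrow> 'e::euclidean_space) \<Rightarrow> 'e \<Rightarrow> 'z measure" where
  "expfam M T l = density M (\<lambda>x. ennreal (expfam_density M T l x))"

definition mean_param :: "'z measure \<Rightarrow> ('z \<Rightarrow> 'e::euclidean_space) \<Rightarrow> 'e \<Rightarrow> 'e" where
  "mean_param M T l = (\<integral>x. T x \<partial>expfam M T l)"

text \<open>
  \<open>nat_param\<close> is arbitrary outside \<open>mean_param M T ` L\<close>; since that set is open in \<open>V\<close>, derivatives
  within \<open>V\<close> at its points do not depend on these values.
\<close>

definition nat_param ::
  "'z measure \<Rightarrow> ('z \<Rightarrow> 'e::euclidean_space) \<Rightarrow> 'e set \<Rightarrow> 'e \<Rightarrow> 'e" where
  "nat_param M T L = inv_into L (mean_param M T)"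

text \<open>
  \<open>prob_expfam\<close> says that the normalising integral is finite and nonzero: if
  \<open>\<lambda>x. exp (T x \<bullet> l)\<close> is not integrable, the Bochner integral is 0 and \<open>expfam M T l\<close> is the null
  measure.
\<close>

locale exponential_family = sigma_finite_measure M
  for M :: "'z measure" and T :: "'z \<Rightarrow> 'e::euclidean_space" and V L :: "'e set" +
  assumes subspace_V: "subspace V"
    and T_measurable: "T \<in> borel_measurable M"
    and T_in_V: "x \<in> space M \<Longrightarrow> T x \<in> V"
    and open_L: "openin (top_of_set V) L"
    and prob_expfam: "l \<in> L \<Longrightarrow> prob_space (expfam M T l)"
    and integrable_T: "l \<in> L \<Longrightarrow> integrable (expfam M T l) T"
    and open_means: "openin (top_of_set V) (mean_param M T ` L)"
    and diffeo_mean: "C1_diffeomorphism L (mean_param M T ` L) (mean_param M T)"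


section \<open>Models and mean-field distributions\<close>

definition joint_density ::
  "'y measure \<Rightarrow> 'w measure \<Rightarrow> ('y \<Rightarrow> 'w \<Rightarrow> real) \<Rightarrow> bool" where
  "joint_density N P p \<longleftrightarrow>
     (\<lambda>(y, z). p y z) \<in> borel_measurable (N \<Otimes>\<^sub>M P) \<and>
     (\<forall>y\<in>space N. \<forall>z\<in>space P. 0 \<le> p y z) \<and>
     (\<integral>\<^sup>+ (y, z). ennreal (p y z) \<partial>(N \<Otimes>\<^sub>M P)) = 1"

text \<open>
  A point \<open>w\<close> of the product over \<open>I - {i}\<close> stands for the variables other than the \<open>i\<close>-th, and
  \<open>w(i := x)\<close> completes it to a point of the product over \<open>I\<close>.
\<close>

definition cond_density ::
  "('i \<Rightarrow> 'z measure) \<Rightarrow> ('y \<Rightarrow> ('i \<Rightarrow> 'z) \<Rightarrow> real) \<Rightarrow> 'y \<Rightarrow> 'i \<Rightarrow> ('i \<Rightarrow> 'z) \<Rightarrow> 'z \<Rightarrow> real" where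
  "cond_density M p y i w x = p y (w(i := x)) / (\<integral>x'. p y (w(i := x')) \<partial>M i)"

definition conditionally_conjugate ::
  "'i set \<Rightarrow> ('i \<Rightarrow> 'z measure) \<Rightarrow> ('i \<Rightarrow> 'z \<Rightarrow> 'e) \<Rightarrow> ('i \<Rightarrow> 'e::euclidean_space set) \<Rightarrow>
   ('y \<Rightarrow> ('i \<Rightarrow> 'z) \<Rightarrow> real) \<Rightarrow> 'y \<Rightarrow> 'i \<Rightarrow> bool" where
  "conditionally_conjugate I M T V p y i \<longleftrightarrow>
     (\<exists>\<eta> :: ('i \<Rightarrow> 'z) \<Rightarrow> 'y \<Rightarrow> 'e. \<forall>w\<in>space (PiM (I - {i}) M).
        \<eta> w y \<in> V i \<and>
        (\<exists>c. \<forall>x\<in>space (M i). ln (cond_density M p y i w x) = T i x \<bullet> \<eta> w y + c))"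

definition mean_field ::
  "'i set \<Rightarrow> ('i \<Rightarrow> 'z measure) \<Rightarrow> ('i \<Rightarrow> 'z \<Rightarrow> 'e::euclidean_space) \<Rightarrow> ('i \<Rightarrow> 'e) \<Rightarrow>
   ('i \<Rightarrow> 'z) measure" where
  "mean_field J M T l = PiM J (\<lambda>j. expfam (M j) (T j) (l j))"

end

theory Submission
  imports Defs
begin

text \<open>
  Conjugacy makes \<open>ln p\<close> affine in \<open>T\<^sub>i\<close> once the other variables are fixed, with slope \<open>\<eta>\<close>. After
  projecting \<open>\<eta>\<close> onto the span of the differences of values of \<open>T\<^sub>i\<close> it is integrable, and its mean
  \<open>h\<close> is the slope of \<open>x \<mapsto> E [ln p]\<close> with respect to \<open>T\<^sub>i x\<close> and also the slope of
  \<open>\<mu>\<^sub>i \<mapsto> E [ln p]\<close>. So (2) says \<open>\<lambda>\<^sub>i\<^sup>* = h\<close>, whereas (1) says that \<open>T\<^sub>i x \<bullet> (\<lambda>\<^sub>i\<^sup>* - h)\<close>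
  does not depend on \<open>x\<close>. The latter forces \<open>\<lambda>\<^sub>i\<^sup>* = h\<close>, since otherwise moving the natural parameter
  along \<open>\<lambda>\<^sub>i\<^sup>* - h\<close> would not change the distribution, and the mean map would not be injective.
\<close>

section \<open>Gradients and averaged slopes in a subspace\<close>

lemma has_gradient_in_unique:
  fixes f :: "'e::euclidean_space \<Rightarrow> real"
  assumes V: "subspace V" and x: "x \<in> V"
    and g: "has_gradient_in V f g x" and h: "has_gradient_in V f h x"
  shows "g = h"
proof -
  define d where "d = g - h"
  have d: "d \<in> V"
    using g h V by (simp add: d_def has_gradient_in_def subspace_diff)
  \<comment> \<open>Composing with the line through \<open>x\<close> in direction \<open>d\<close>,
    which stays in \<open>V\<close>, turns a derivative within \<open>V\<close> into an ordinary one
    at 0, where derivatives are unique.\<close>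
  have line: "((\<lambda>t::real. x + t *\<^sub>R d) has_derivative (\<lambda>t. t *\<^sub>R d)) (at 0)"
    by (auto intro!: derivative_eq_intros)
  have range: "range (\<lambda>t::real. x + t *\<^sub>R d) \<subseteq> V"
    using V x d by (auto intro: subspace_add subspace_scale)
  have comp: "((\<lambda>t. f (x + t *\<^sub>R d)) has_derivative (\<lambda>t. (t *\<^sub>R d) \<bullet> k)) (at 0)"
    if "has_gradient_in V f k x" for k
  proof (rule has_derivative_in_compose[OF line])
    show "(f has_derivative (\<lambda>h. h \<bullet> k)) (at (x + 0 *\<^sub>R d) within range (\<lambda>t. x + t *\<^sub>R d))"
      using that range by (auto simp: has_gradient_in_def intro: has_derivative_subset)
  qed
  have "(\<lambda>t. (t *\<^sub>R d) \<bullet> g) = (\<lambda>t. (t *\<^sub>R d) \<bullet> h)"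
    by (rule has_derivative_unique[OF comp[OF g] comp[OF h]])
  then have "d \<bullet> g = d \<bullet> h"
    by (metis scaleR_one)
  then have "d \<bullet> d = 0"
    by (simp add: d_def inner_diff_right)
  then show ?thesis
    by (simp add: d_def)
qed

text \<open>Near \<open>x\<close>, all points of \<open>V\<close> lie in \<open>S\<close>, so values
  of \<open>f\<close> off \<open>S\<close> do not matter. This deals with the arbitrary values of
  \<open>nat_param\<close> outside the set of means.\<close>

lemma has_gradient_in_affine:
  fixes f :: "'e::euclidean_space \<Rightarrow> real"
  assumes S: "openin (top_of_set V) S" and x: "x \<in> S" and h: "h \<in> V"
    and eq: "\<And>m. m \<in> S \<Longrightarrow> f m = (m - a) \<bullet> h + c"
  shows "has_gradient_in V f h x"
proof -
  obtain U where U: "open U" "S = V \<inter> U"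
    using S by (auto simp: openin_open)
  have "((\<lambda>m. (m - a) \<bullet> h + c) has_derivative (\<lambda>k. k \<bullet> h)) (at x within V)"
    by (auto intro!: derivative_eq_intros)
  moreover have "eventually (\<lambda>m. (m - a) \<bullet> h + c = f m) (at x within V)"
    using U x eq by (auto simp: eventually_at_topological)
  ultimately have "(f has_derivative (\<lambda>k. k \<bullet> h)) (at x within V)"
    using U x eq by (auto intro: has_derivative_transform_eventually)
  with h show ?thesis
    by (simp add: has_gradient_in_def)
qed

text \<open>
  The slope \<open>\<eta>\<close> itself need not be measurable: only its components along differences of values of
  \<open>T\<close> are determined by \<open>f\<close>.
\<close>

lemma integrable_slope:
  fixes f :: "'w \<Rightarrow> 'x \<Rightarrow> real" and T :: "'x \<Rightarrow> 'e::euclidean_space"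
  assumes V: "subspace V" and T: "\<And>x. x \<in> X \<Longrightarrow> T x \<in> V" and a: "a \<in> X"
    and affine: "\<And>w x. w \<in> space Q \<Longrightarrow> x \<in> X \<Longrightarrow> f w x = T x \<bullet> \<eta> w + c w"
    and int: "\<And>x. x \<in> X \<Longrightarrow> integrable Q (\<lambda>w. f w x)"
  obtains \<theta> where "integrable Q \<theta>" "(\<integral>w. \<theta> w \<partial>Q) \<in> V"
    "\<And>w x. w \<in> space Q \<Longrightarrow> x \<in> X \<Longrightarrow> f w x = (T x - T a) \<bullet> \<theta> w + f w a"
proof -
  define D where "D = span ((\<lambda>x. T x - T a) ` X)"
  have D_V: "D \<subseteq> V"
    unfolding D_def using V T a by (intro span_minimal) (auto intro: subspace_diff)
  obtain B where B: "B \<subseteq> D" "pairwise orthogonal B" "\<And>b. b \<in> B \<Longrightarrow> norm b = 1"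
      "independent B" "card B = dim D" "span B = D"
    using orthonormal_basis_subspace[of D] subspace_span unfolding D_def by metis
  have fin: "finite B"
    using B(4) by (rule independent_imp_finite)
  \<comment> \<open>On a generator \<open>T x - T a\<close> the unknown \<open>c w\<close> cancels:
    the inner product with \<open>\<eta> w\<close> is \<open>f w x - f w a\<close>, which is
    integrable. Linearity extends this to \<open>D\<close>.\<close>
  have int_D: "integrable Q (\<lambda>w. d \<bullet> \<eta> w)" if "d \<in> D" for d
    using that unfolding D_def
  proof (induction rule: span_induct_alt)
    case base
    then show ?case by simp
  next
    case (step r d e)
    then obtain x where x: "x \<in> X" "d = T x - T a"
      by auto
    have "integrable Q (\<lambda>w. r * (f w x - f w a) + e \<bullet> \<eta> w)"
      using int x(1) a step by auto
    also have "?this \<longleftrightarrow> integrable Q (\<lambda>w. (r *\<^sub>R d + e) \<bullet> \<eta> w)"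
      using x a by (intro Bochner_Integration.integrable_cong)
        (auto simp: affine inner_add_left inner_diff_left)
    finally show ?case .
  qed
  \<comment> \<open>The orthogonal projection of \<open>\<eta> w\<close> onto \<open>D\<close>, in
    the orthonormal basis \<open>B\<close>. Its coordinates are integrable by
    \<open>int_D\<close>.\<close>
  define \<theta> where "\<theta> w = (\<Sum>b\<in>B. (b \<bullet> \<eta> w) *\<^sub>R b)" for w
  have int_B: "integrable Q (\<lambda>w. (b \<bullet> \<eta> w) *\<^sub>R b)" if "b \<in> B" for b
    using int_D B(1) that by (intro integrable_scaleR_left) auto
  have "(\<integral>w. \<theta> w \<partial>Q) = (\<Sum>b\<in>B. (\<integral>w. b \<bullet> \<eta> w \<partial>Q) *\<^sub>R b)"
    unfolding \<theta>_def using int_B int_D B(1)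
    by (subst Bochner_Integration.integral_sum)
      (auto intro!: sum.cong integral_scaleR_left)
  also have "\<dots> \<in> V"
    using V B(1) D_V by (intro subspace_sum subspace_scale) auto
  finally have "(\<integral>w. \<theta> w \<partial>Q) \<in> V" .
  moreover have "integrable Q \<theta>"
    unfolding \<theta>_def using int_B by auto
  moreover have proj: "d \<bullet> \<theta> w = d \<bullet> \<eta> w" if "d \<in> D" for d w
  proof -
    have "d \<in> span B"
      using that B(6) by simp
    then show ?thesis
    proof (induction rule: span_induct_alt)
      case base
      then show ?case by simp
    next
      case (step r d e)
      have "d \<bullet> \<theta> w = (\<Sum>b\<in>B. if b = d then d \<bullet> \<eta> w else 0)"
        unfolding \<theta>_def inner_sum_right
        using B(2,3) step(1)
        by (intro sum.cong) (auto simp: pairwise_def orthogonal_def dot_square_norm)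
      also have "\<dots> = d \<bullet> \<eta> w"
        using fin step(1) by simp
      finally show ?case
        using step by (simp add: inner_add_left)
    qed
  qed
  have "f w x = (T x - T a) \<bullet> \<theta> w + f w a" if "w \<in> space Q" "x \<in> X" for w x
  proof -
    have "T x - T a \<in> D"
      unfolding D_def using that by (intro span_base) auto
    then have "(T x - T a) \<bullet> \<theta> w = (T x - T a) \<bullet> \<eta> w"
      by (rule proj)
    then show ?thesis
      using that a by (simp add: affine inner_diff_left)
  qed
  ultimately show ?thesis
    using that by blast
qed

section \<open>Normalisation and identifiability of an exponential family\<close>

context exponential_family
begin

lemma space_expfam [simp]: "space (expfam M T l) = space M"
  by (simp add: expfam_def)

text \<open>A zero normaliser would make the density 0, as division by zero gives 0, and the family
  member would be the null measure.\<close>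

lemma normaliser_pos:
  assumes "l \<in> L"
  shows "0 < (\<integral>x. exp (T x \<bullet> l) \<partial>M)"
proof (rule ccontr)
  assume "\<not> ?thesis"
  moreover have "0 \<le> (\<integral>x. exp (T x \<bullet> l) \<partial>M)"
    by (rule Bochner_Integration.integral_nonneg) simp
  ultimately have "expfam M T l = density M (\<lambda>_. 0)"
    by (simp add: expfam_def expfam_density_def)
  then have "emeasure (expfam M T l) (space (expfam M T l)) = 0"
    by (simp add: emeasure_density)
  then show False
    using prob_space.emeasure_space_1[OF prob_expfam[OF assms]] by simp
qed

lemma not_AE_False:
  assumes "l \<in> L"
  shows "\<not> (AE x in M. False)"
proof
  assume "AE x in M. False"
  then have "(\<integral>x. exp (T x \<bullet> l) \<partial>M) = 0"
    by (intro integral_eq_zero_AE) auto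
  then show False
    using normaliser_pos[OF assms] by simp
qed

lemma ln_expfam_density:
  assumes "l \<in> L"
  shows "ln (expfam_density M T l x) = T x \<bullet> l - ln (\<integral>x. exp (T x \<bullet> l) \<partial>M)"
  using normaliser_pos[OF assms] by (simp add: expfam_density_def ln_div)

lemma inj_on_mean_param: "inj_on (mean_param M T) L"
  using diffeo_mean unfolding C1_diffeomorphism_def homeomorphism_def
  by (metis inj_on_inverseI)

lemma nat_param_mean_param: "l \<in> L \<Longrightarrow> nat_param M T L (mean_param M T l) = l"
  by (simp add: nat_param_def inj_on_mean_param)

text \<open>The shift multiplies numerator and normaliser by the same factor
  \<open>exp c\<close>.\<close>

lemma expfam_translate:
  assumes const: "\<And>x. x \<in> space M \<Longrightarrow> T x \<bullet> d = c"
  shows "expfam M T (l + d) = expfam M T l"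
proof -
  have e: "exp (T x \<bullet> (l + d)) = exp (T x \<bullet> l) * exp c" if "x \<in> space M" for x
    using that by (simp add: const inner_add_right exp_add)
  have "(\<integral>x. exp (T x \<bullet> (l + d)) \<partial>M) = (\<integral>x. exp (T x \<bullet> l) * exp c \<partial>M)"
    by (intro Bochner_Integration.integral_cong) (auto simp: e)
  then have "expfam_density M T (l + d) x = expfam_density M T l x" if "x \<in> space M" for x
    using that by (simp add: expfam_density_def e)
  moreover have "(\<lambda>x. ennreal (expfam_density M T k x)) \<in> borel_measurable M" for k
    unfolding expfam_density_def using T_measurable by measurable
  ultimately show ?thesis
    unfolding expfam_def by (intro density_cong) auto
qed

lemma constant_statistic_imp_zero:
  assumes l: "l \<in> L" and d: "d \<in> V" and const: "\<And>x. x \<in> space M \<Longrightarrow> T x \<bullet> d = c"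
  shows "d = 0"
proof -
  obtain U where U: "open U" "L = V \<inter> U"
    using open_L by (auto simp: openin_open)
  \<comment> \<open>Openness of \<open>L\<close> in \<open>V\<close> leaves room for a small
    positive step along \<open>d\<close>; it leaves the mean unchanged, so injectivity forces
    \<open>d\<close> to vanish.\<close>
  have "((\<lambda>t. l + t *\<^sub>R d) \<longlongrightarrow> l + 0 *\<^sub>R d) (at_right (0::real))"
    by (intro tendsto_intros)
  then have "eventually (\<lambda>t. l + t *\<^sub>R d \<in> U) (at_right (0::real))"
    using U l by (intro topological_tendstoD) auto
  then have "eventually (\<lambda>t::real. l + t *\<^sub>R d \<in> U \<and> 0 < t) (at_right 0)"
    using eventually_at_right_less by (rule eventually_conj)
  then obtain t :: real where t: "l + t *\<^sub>R d \<in> U" "0 < t"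
    by (metis (no_types, lifting) eventually_happens trivial_limit_at_right_real)
  have "l + t *\<^sub>R d \<in> L"
    using t U l d subspace_V by (auto intro: subspace_add subspace_scale)
  moreover have "mean_param M T (l + t *\<^sub>R d) = mean_param M T l"
    unfolding mean_param_def
    by (subst expfam_translate[where c = "t * c"]) (auto simp: const)
  ultimately have "l + t *\<^sub>R d = l"
    using l inj_on_mean_param by (auto dest: inj_onD)
  with t show ?thesis
    by simp
qed

lemma mean_param_in_V:
  assumes "l \<in> L"
  shows "mean_param M T l \<in> V"
  using open_means assms openin_imp_subset by blast

end

section \<open>From the conditional to the joint density, and Fubini for the mean field\<close>

lemma conditionally_conjugateE:
  assumes conj: "conditionally_conjugate I M T V p y i"
    and fam: "exponential_family (M i) (T i) (V i) (L i)" and l: "l \<in> L i" and i: "i \<in> I"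
    and pos: "\<And>z. z \<in> space (PiM I M) \<Longrightarrow> 0 < p y z"
    and int: "\<And>w. w \<in> space (PiM (I - {i}) M) \<Longrightarrow> integrable (M i) (\<lambda>x. p y (w(i := x)))"
  obtains \<eta> c where "\<And>w x. w \<in> space (PiM (I - {i}) M) \<Longrightarrow> x \<in> space (M i) \<Longrightarrow>
    ln (p y (w(i := x))) = T i x \<bullet> \<eta> w + c w"
proof -
  interpret F: exponential_family "M i" "T i" "V i" "L i"
    by (rule fam)
  obtain \<eta> c where \<eta>: "\<And>w x. w \<in> space (PiM (I - {i}) M) \<Longrightarrow> x \<in> space (M i) \<Longrightarrow>
      ln (cond_density M p y i w x) = T i x \<bullet> \<eta> w y + c w"
    using conj unfolding conditionally_conjugate_def by metis
  define Z where "Z w = (\<integral>x. p y (w(i := x)) \<partial>M i)" for w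
  have p_pos: "0 < p y (w(i := x))" if "w \<in> space (PiM (I - {i}) M)" "x \<in> space (M i)" for w x
  proof -
    have "w(i := x) \<in> space (PiM (insert i (I - {i})) M)"
      using that unfolding space_PiM by (rule PiE_fun_upd[rotated])
    then show ?thesis
      using i pos by (simp add: insert_absorb)
  qed
  \<comment> \<open>Log conditional and log joint differ by \<open>ln (Z w)\<close>, which is free
    of \<open>x\<close> and joins the constant.\<close>
  have "ln (p y (w(i := x))) = T i x \<bullet> \<eta> w y + (c w + ln (Z w))"
    if wx: "w \<in> space (PiM (I - {i}) M)" "x \<in> space (M i)" for w x
  proof -
    have nn: "AE x in M i. 0 \<le> p y (w(i := x))"
      using p_pos[OF wx(1)] by (intro AE_I2) (auto intro: less_imp_le)
    \<comment> \<open>A positive integrand with zero integral would make \<open>M i\<close> a null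
      measure.\<close>
    have "Z w \<noteq> 0"
    proof
      assume "Z w = 0"
      then have "AE x in M i. p y (w(i := x)) = 0"
        using integral_nonneg_eq_0_iff_AE[OF int[OF wx(1)] nn] by (simp add: Z_def)
      then have "AE x in M i. False"
      proof (rule AE_mp, intro AE_I2 impI)
        fix x assume "x \<in> space (M i)" "p y (w(i := x)) = 0"
        then show False
          using p_pos[OF wx(1), of x] by simp
      qed
      then show False
        using F.not_AE_False[OF l] by simp
    qed
    moreover have "0 \<le> Z w"
      unfolding Z_def using nn by (rule integral_nonneg_AE)
    ultimately have "ln (cond_density M p y i w x) = ln (p y (w(i := x))) - ln (Z w)"
      using p_pos[OF wx] by (simp add: cond_density_def Z_def ln_div)
    then show ?thesis
      using \<eta>[OF wx] by simp
  qed
  then show ?thesis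
    by (rule that)
qed

text \<open>Fubini with the \<open>i\<close>-th variable innermost. Only the inner integral depends
  on \<open>l\<close>, so the dependence on the \<open>i\<close>-th mean can be read off
  there.\<close>

lemma integral_mean_field_remove:
  fixes f :: "('i \<Rightarrow> 'z) \<Rightarrow> real"
  assumes "finite I" and i: "i \<in> I"
    and fam: "\<And>j. j \<in> I \<Longrightarrow> exponential_family (M j) (T j) (V j) (L j)"
    and k: "\<And>j. j \<in> I \<Longrightarrow> k j \<in> L j"
    and l: "l \<in> L i"
    and int: "integrable (mean_field I M T (k(i := l))) f"
  shows "(\<integral>z. f z \<partial>mean_field I M T (k(i := l))) =
    (\<integral>w. (\<integral>x. f (w(i := x)) \<partial>expfam (M i) (T i) l) \<partial>mean_field (I - {i}) M T k)"
proof -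
  \<comment> \<open>\<open>product_sigma_finite\<close> constrains the factors outside the index set as well.\<close>
  define E where "E j = (if j \<in> I - {i} then expfam (M j) (T j) (k j) else expfam (M i) (T i) l)" for j
  have prob: "prob_space (E j)" for j
    using exponential_family.prob_expfam[OF fam] k l i by (auto simp: E_def)
  interpret product_sigma_finite E
    using prob by (intro product_sigma_finite.intro prob_space_imp_sigma_finite)
  have I: "mean_field I M T (k(i := l)) = PiM (insert i (I - {i})) E"
    unfolding mean_field_def using i by (intro PiM_cong) (auto simp: E_def)
  have J: "mean_field (I - {i}) M T k = PiM (I - {i}) E"
    unfolding mean_field_def by (intro PiM_cong) (auto simp: E_def)
  have "E i = expfam (M i) (T i) l"
    by (simp add: E_def)
  then show ?thesis
    using product_integral_insert[of "I - {i}" i f] int \<open>finite I\<close>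
    unfolding I J by (simp del: insert_Diff_single)
qed

lemma space_mean_field: "space (mean_field J M T k) = space (PiM J M)"
  by (simp add: mean_field_def space_PiM expfam_def)

section \<open>Both conditions reduced to one equation for the natural parameter\<close>

theorem mainTheorem1:
  fixes K :: nat
    and M :: "nat \<Rightarrow> 'z measure"
    and N :: "'y measure"
    and T :: "nat \<Rightarrow> 'z \<Rightarrow> 'e::euclidean_space"
    and V L :: "nat \<Rightarrow> 'e set"
    and p :: "'y \<Rightarrow> (nat \<Rightarrow> 'z) \<Rightarrow> real"
    and y :: 'y
    and lstar :: "nat \<Rightarrow> 'e"
  defines "I \<equiv> {1..K}"
  assumes family: "\<And>i. i \<in> I \<Longrightarrow> exponential_family (M i) (T i) (V i) (L i)"
    and lstar: "\<And>i. i \<in> I \<Longrightarrow> lstar i \<in> L i"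
    and N: "sigma_finite_measure N"
    and model: "joint_density N (PiM I M) p"
    and y: "y \<in> space N"
    and pos: "\<And>z. z \<in> space (PiM I M) \<Longrightarrow> 0 < p y z"
    and cond_ex: "\<And>i w. i \<in> I \<Longrightarrow> w \<in> space (PiM (I - {i}) M) \<Longrightarrow>
      integrable (M i) (\<lambda>x. p y (w(i := x)))"
    and conj: "\<And>i. i \<in> I \<Longrightarrow> conditionally_conjugate I M T V p y i"
    and exp_others: "\<And>i x. i \<in> I \<Longrightarrow> x \<in> space (M i) \<Longrightarrow>
      integrable (mean_field (I - {i}) M T lstar) (\<lambda>w. ln (p y (w(i := x))))"
    and exp_all: "\<And>i l. i \<in> I \<Longrightarrow> l \<in> L i \<Longrightarrow>
      integrable (mean_field I M T (lstar(i := l))) (\<lambda>z. ln (p y z))"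
  shows "\<forall>i\<in>I.
    (\<exists>c. \<forall>x\<in>space (M i).
       ln (expfam_density (M i) (T i) (lstar i) x) =
       (\<integral>w. ln (p y (w(i := x))) \<partial>mean_field (I - {i}) M T lstar) + c)
    \<longleftrightarrow>
    has_gradient_in (V i)
      (\<lambda>\<mu>. \<integral>z. ln (p y z) \<partial>mean_field I M T (lstar(i := nat_param (M i) (T i) (L i) \<mu>)))
      (lstar i)
      (mean_param (M i) (T i) (lstar i))"
proof
  fix i assume i: "i \<in> I"
  interpret F: exponential_family "M i" "T i" "V i" "L i"
    by (rule family[OF i])
  let ?Q = "mean_field (I - {i}) M T lstar"
  let ?m = "mean_param (M i) (T i)"
  define G where "G x = (\<integral>w. ln (p y (w(i := x))) \<partial>?Q)" for x
  define H where "H \<mu> = (\<integral>z. ln (p y z) \<partial>mean_field I M T (lstar(i := nat_param (M i) (T i) (L i) \<mu>)))"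
    for \<mu>
  have l: "lstar i \<in> L i"
    using lstar i .
  obtain a where a: "a \<in> space (M i)"
    using prob_space.not_empty[OF F.prob_expfam[OF l]] by auto
  obtain \<eta> c where \<eta>: "\<And>w x. w \<in> space (PiM (I - {i}) M) \<Longrightarrow> x \<in> space (M i) \<Longrightarrow>
      ln (p y (w(i := x))) = T i x \<bullet> \<eta> w + c w"
    using conditionally_conjugateE[where I = I and M = M and T = T and V = V and L = L
        and p = p and y = y and i = i, OF conj[OF i] family[OF i] l i pos cond_ex[OF i]]
    by blast
  obtain \<theta> where \<theta>: "integrable ?Q \<theta>" "(\<integral>w. \<theta> w \<partial>?Q) \<in> V i"
    "\<And>w x. w \<in> space ?Q \<Longrightarrow> x \<in> space (M i) \<Longrightarrow>
      ln (p y (w(i := x))) = (T i x - T i a) \<bullet> \<theta> w + ln (p y (w(i := a)))"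
    using integrable_slope[where X = "space (M i)" and T = "T i" and Q = ?Q and \<eta> = \<eta> and c = c
        and f = "\<lambda>w x. ln (p y (w(i := x)))", OF F.subspace_V F.T_in_V a]
      \<eta> exp_others[OF i] unfolding space_mean_field by blast
  define h where "h = (\<integral>w. \<theta> w \<partial>?Q)"
  \<comment> \<open>Used twice: with \<open>v = T i x - T i a\<close> for \<open>G\<close>, and with
    \<open>v = \<mu> - T i a\<close> for \<open>H\<close>.\<close>
  have slope: "(\<integral>w. v \<bullet> \<theta> w + ln (p y (w(i := a))) \<partial>?Q) = v \<bullet> h + G a" for v
    unfolding h_def G_def using \<theta>(1) exp_others[OF i a] by simp
  have G: "G x = (T i x - T i a) \<bullet> h + G a" if "x \<in> space (M i)" for x
    unfolding slope[symmetric] unfolding G_def using that \<theta>(3)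
    by (intro Bochner_Integration.integral_cong) auto
  have H: "H \<mu> = (\<mu> - T i a) \<bullet> h + G a" if \<mu>: "\<mu> \<in> ?m ` L i" for \<mu>
  proof -
    obtain k where k: "k \<in> L i" "\<mu> = ?m k"
      using \<mu> by auto
    interpret q: prob_space "expfam (M i) (T i) k"
      by (rule F.prob_expfam[OF k(1)])
    have "H \<mu> = (\<integral>w. (\<integral>x. ln (p y (w(i := x))) \<partial>expfam (M i) (T i) k) \<partial>?Q)"
      unfolding H_def k(2) F.nat_param_mean_param[OF k(1)]
      using i family lstar k(1) exp_all[OF i k(1)]
      by (intro integral_mean_field_remove) (auto simp: I_def)
    \<comment> \<open>The inner integrand is affine in \<open>T i x\<close>, so averaging over a
      probability measure replaces \<open>T i x\<close> by its mean \<open>\<mu>\<close>.\<close>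
    also have "\<dots> = (\<integral>w. (\<mu> - T i a) \<bullet> \<theta> w + ln (p y (w(i := a))) \<partial>?Q)"
    proof (intro Bochner_Integration.integral_cong refl)
      fix w assume w: "w \<in> space ?Q"
      have "(\<integral>x. ln (p y (w(i := x))) \<partial>expfam (M i) (T i) k) =
          (\<integral>x. (T i x - T i a) \<bullet> \<theta> w + ln (p y (w(i := a))) \<partial>expfam (M i) (T i) k)"
        using \<theta>(3)[OF w] by (intro Bochner_Integration.integral_cong) auto
      also have "\<dots> = (\<mu> - T i a) \<bullet> \<theta> w + ln (p y (w(i := a)))"
        using F.integrable_T[OF k(1)] q.prob_space by (simp add: k(2) mean_param_def)
      finally show "(\<integral>x. ln (p y (w(i := x))) \<partial>expfam (M i) (T i) k) =
        (\<mu> - T i a) \<bullet> \<theta> w + ln (p y (w(i := a)))" .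
    qed
    finally show ?thesis
      by (simp only: slope)
  qed
  have grad: "has_gradient_in (V i) H h (?m (lstar i))"
    using F.open_means H l \<theta>(2) by (intro has_gradient_in_affine[where S = "?m ` L i"]) (auto simp: h_def)
  have "(\<exists>c. \<forall>x\<in>space (M i). ln (expfam_density (M i) (T i) (lstar i) x) = G x + c)
    \<longleftrightarrow> lstar i = h"
  proof
    assume "\<exists>c. \<forall>x\<in>space (M i). ln (expfam_density (M i) (T i) (lstar i) x) = G x + c"
    then obtain c where
      c: "\<And>x. x \<in> space (M i) \<Longrightarrow> ln (expfam_density (M i) (T i) (lstar i) x) = G x + c"
      by auto
    \<comment> \<open>The right-hand side is free of \<open>x\<close>, so the statistic is constant
      along \<open>lstar i - h\<close>.\<close>
    have "T i x \<bullet> (lstar i - h) =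
        ln (\<integral>x. exp (T i x \<bullet> lstar i) \<partial>M i) + G a + c - T i a \<bullet> h" if "x \<in> space (M i)" for x
      using c[OF that] G[OF that]
      by (simp add: F.ln_expfam_density[OF l] inner_diff_left inner_diff_right)
    moreover have "lstar i - h \<in> V i"
      using l F.open_L \<theta>(2) F.subspace_V openin_imp_subset
      by (fastforce simp: h_def intro: subspace_diff)
    ultimately have "lstar i - h = 0"
      using F.constant_statistic_imp_zero[OF l] by blast
    then show "lstar i = h"
      by simp
  next
    assume "lstar i = h"
    then show "\<exists>c. \<forall>x\<in>space (M i). ln (expfam_density (M i) (T i) (lstar i) x) = G x + c"
      using G
      \<comment> \<open>The witness solves \<open>T i x \<bullet> h - ln Z = (T i x - T i a)
        \<bullet> h + G a + c\<close> for \<open>c\<close>, with \<open>Z\<close> the normaliser at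
        \<open>h\<close>.\<close>
      by (intro exI[of _ "T i a \<bullet> h - G a - ln (\<integral>x. exp (T i x \<bullet> h) \<partial>M i)"])
        (auto simp: F.ln_expfam_density[OF l] inner_diff_left)
  qed
  \<comment> \<open>\<open>h\<close> is a gradient of \<open>H\<close> at the mean, and the only one
    in \<open>V i\<close>.\<close>
  also have "\<dots> \<longleftrightarrow> has_gradient_in (V i) H (lstar i) (?m (lstar i))"
    using has_gradient_in_unique[OF F.subspace_V F.mean_param_in_V[OF l] _ grad] grad by metis
  finally show "(\<exists>c. \<forall>x\<in>space (M i). ln (expfam_density (M i) (T i) (lstar i) x) =
       (\<integral>w. ln (p y (w(i := x))) \<partial>?Q) + c)
    \<longleftrightarrow> has_gradient_in (V i)
      (\<lambda>\<mu>. \<integral>z. ln (p y z) \<partial>mean_field I M T (lstar(i := nat_param (M i) (T i) (L i) \<mu>)))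
      (lstar i) (?m (lstar i))"
    unfolding G_def H_def .
qed

end
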